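(* Let $\kappa$ be an uncountable ordinal number with $\kappa\le\mathrm{cov}(\mathcal M)$ such that $\kappa$ is regular or $\kappa<\mathrm{cov}(\mathcal M)$. Let $m$ be a natural number, let $X_1,\dots,X_m\subseteq[\mathbb N]^\infty$ be $\kappa$-generalized towers, and let $Y$ be a set of reals satisfying $\binom{\Omega}{\Gamma}$. Then the product space $(X_1\cup\mathrm{Fin})\times\dots\times(X_m\cup\mathrm{Fin})\times Y$ satisfies $\mathsf S_1(\Omega,\Omega)$.
   Context: $\mathbb N=\{1,2,\dots\}$; $[\mathbb N]^\infty$ is the set of infinite subsets of $\mathbb N$ and $\mathrm{Fin}$ the set of finite subsets of $\mathbb N$. Both are viewed as subspaces of $P(\mathbb N)$, which is identified with the Cantor space $\{0,1\}^{\mathbb N}$ via characteristic functions. Each $a\in[\mathbb N]^\infty$ is identified with its increasing enumeration $a(1)<a(2)<\cdots$. For $n<m$, $[n,m)=\{i\in\mathbb N: n\le i<m\}$. A set of reals is a space homeomorphic to a subset of the real line. $\mathrm{cov}(\mathcal M)$ is the minimal cardinality of a family of meager subsets of the Baire space $\mathbb N^{\mathbb N}$ that covers $\mathbb N^{\mathbb N}$. For an uncountable ordinal $\kappa$, a set $X\subseteq[\mathbb N]^\infty$ with $|X|\ge\kappa$ is a $\kappa$-generalized tower if for each $a\in[\mathbb N]^\infty$ there are $b\in[\mathbb N]^\infty$ and $S\subseteq X$ with $|S|<\kappa$ such that $x\cap\bigcup_{n\in b}[a(n),a(n+1))$ is finite for all $x\in X\setminus S$. A cover of a space is a family of proper subsets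 whose union is the whole space. An $\omega$-cover is an open cover such that each finite subset of the space is contained in a member of the cover; $\Omega(X)$ is the family of all $\omega$-covers of $X$. A $\gamma$-cover is an infinite cover such that each point belongs to all but finitely many members. A space satisfies $\binom{\Omega}{\Gamma}$ if every $\omega$-cover of it contains a $\gamma$-cover of it. $X$ satisfies $\mathsf S_1(\Omega,\Omega)$ if for each sequence $\mathcal U_1,\mathcal U_2,\dots\in\Omega(X)$ there are $U_1\in\mathcal U_1,U_2\in\mathcal U_2,\dots$ with $\{U_n:n\in\mathbb N\}\in\Omega(X)$. *)

theory Defs
  imports "HOL-Analysis.Analysis"
begin

unbundle cardinal_syntax

text \<open>
  The set of positive integers is represented by the type \<^typ>\<open>nat\<close> through the order isomorphism
  \<open>n \<mapsto> n - 1\<close>. Ordinals are represented by well-orders, of arbitrary carrier type, and compared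
  by \<open>\<le>o\<close> and \<open><o\<close>; \<open>|A|\<close> is the initial ordinal of the cardinality of \<open>A\<close>.
\<close>

definition uncountable_ordinal :: "'k rel \<Rightarrow> bool" where
  "uncountable_ordinal \<kappa> \<longleftrightarrow> Well_order \<kappa> \<and> uncountable (Field \<kappa>)"

text \<open>
  A successor ordinal has no \<^const>\<open>cofinal\<close> subset in the (strict) sense of the library, so
  \<^const>\<open>regularCard\<close> holds vacuously for it; the conjunct \<^const>\<open>Card_order\<close> excludes this case.
\<close>

definition regular_ordinal :: "'k rel \<Rightarrow> bool" where
  "regular_ordinal \<kappa> \<longleftrightarrow> Card_order \<kappa> \<and> regularCard \<kappa>"

definition nowhere_dense_in :: "'a topology \<Rightarrow> 'a set \<Rightarrow> bool" where
  "nowhere_dense_in T A \<longleftrightarrow> A \<subseteq> topspace T \<and> T interior_of (T closure_of A) = {}"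

definition meager_in :: "'a topology \<Rightarrow> 'a set \<Rightarrow> bool" where
  "meager_in T A \<longleftrightarrow> (\<exists>\<N>. countable \<N> \<and> (\<forall>N\<in>\<N>. nowhere_dense_in T N) \<and> A = \<Union>\<N>)"

definition baire_space :: "(nat \<Rightarrow> nat) topology" where
  "baire_space = product_topology (\<lambda>_. discrete_topology UNIV) UNIV"

definition meager_covers :: "(nat \<Rightarrow> nat) set set set" where
  "meager_covers = {\<F>. (\<forall>A\<in>\<F>. meager_in baire_space A) \<and> \<Union>\<F> = topspace baire_space}"

text \<open>The choice is unique up to \<open>=o\<close>, that is, as an ordinal.\<close>

definition cov_meager :: "(nat \<Rightarrow> nat) set rel" where
  "cov_meager =
    (SOME r. r \<in> card_of ` meager_covers \<and> (\<forall>\<F>\<in>meager_covers. r \<le>o |\<F>| ))"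

definition generalized_tower :: "'k rel \<Rightarrow> nat set set \<Rightarrow> bool" where
  "generalized_tower \<kappa> X \<longleftrightarrow>
    X \<subseteq> {x. infinite x} \<and> \<kappa> \<le>o |X| \<and>
    (\<forall>a. infinite a \<longrightarrow>
      (\<exists>b S. infinite b \<and> S \<subseteq> X \<and> |S| <o \<kappa> \<and>
        (\<forall>x \<in> X - S. finite (x \<inter> (\<Union>n\<in>b. {enumerate a n ..< enumerate a (Suc n)})))))"

definition powerset_space :: "nat set topology" where
  "powerset_space =
    pullback_topology UNIV (\<lambda>A n. n \<in> A) (product_topology (\<lambda>_. discrete_topology (UNIV :: bool set)) UNIV)"

definition set_of_reals :: "'a topology \<Rightarrow> bool" where
  "set_of_reals T \<longleftrightarrow> (\<exists>A :: real set. T homeomorphic_space top_of_set A)"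

definition is_cover :: "'a topology \<Rightarrow> 'a set set \<Rightarrow> bool" where
  "is_cover T \<U> \<longleftrightarrow> (\<forall>U\<in>\<U>. U \<subset> topspace T) \<and> \<Union>\<U> = topspace T"

definition omega_covers :: "'a topology \<Rightarrow> 'a set set set" where
  "omega_covers T =
    {\<U>. is_cover T \<U> \<and> (\<forall>U\<in>\<U>. openin T U) \<and>
         (\<forall>F. finite F \<and> F \<subseteq> topspace T \<longrightarrow> (\<exists>U\<in>\<U>. F \<subseteq> U))}"

definition gamma_cover :: "'a topology \<Rightarrow> 'a set set \<Rightarrow> bool" where
  "gamma_cover T \<U> \<longleftrightarrow>
    infinite \<U> \<and> is_cover T \<U> \<and> (\<forall>x\<in>topspace T. finite {U\<in>\<U>. x \<notin> U})"

definition Omega_choose_Gamma :: "'a topology \<Rightarrow> bool" where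
  "Omega_choose_Gamma T \<longleftrightarrow> (\<forall>\<U>\<in>omega_covers T. \<exists>\<V>\<subseteq>\<U>. gamma_cover T \<V>)"

definition S1_Omega_Omega :: "'a topology \<Rightarrow> bool" where
  "S1_Omega_Omega T \<longleftrightarrow>
    (\<forall>\<U> :: nat \<Rightarrow> 'a set set. (\<forall>n. \<U> n \<in> omega_covers T) \<longrightarrow>
      (\<exists>U. (\<forall>n. U n \<in> \<U> n) \<and> range U \<in> omega_covers T))"

lemma meager_covers_nonempty: "meager_covers \<noteq> {}"
proof -
  have "nowhere_dense_in baire_space {f}" for f
  proof -
    have "Hausdorff_space baire_space"
      by (simp add: baire_space_def Hausdorff_space_product_topology Hausdorff_space_discrete_topology)
    hence cl: "closedin baire_space {f}"
      by (simp add: closedin_Hausdorff_singleton baire_space_def PiE_UNIV_domain)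
    have "\<not> openin baire_space {f}"
    proof
      assume "openin baire_space {f}"
      then obtain V where V: "finite {i. V i \<noteq> UNIV}" "f \<in> Pi\<^sub>E UNIV V" "Pi\<^sub>E UNIV V \<subseteq> {f}"
        unfolding baire_space_def openin_product_topology_alt by auto
      obtain k where k: "V k = UNIV"
        using V(1) by (metis (mono_tags, lifting) UNIV_eq_I infinite_UNIV_nat mem_Collect_eq)
      have "f(k := Suc (f k)) \<in> Pi\<^sub>E UNIV V"
        using V(2) k by (auto simp: PiE_UNIV_domain Pi_iff)
      hence "f(k := Suc (f k)) = f" using V(3) by blast
      thus False by (metis fun_upd_same n_not_Suc_n)
    qed
    hence "baire_space interior_of {f} = {}"
      by (metis interior_of_subset openin_interior_of subset_singletonD)
    thus ?thesis
      using cl by (simp add: nowhere_dense_in_def closure_of_closedin baire_space_def PiE_UNIV_domain)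
  qed
  hence "meager_in baire_space {f}" for f
    unfolding meager_in_def by (intro exI[of _ "{{f}}"]) auto
  hence "range (\<lambda>f. {f}) \<in> meager_covers"
    by (auto simp: meager_covers_def baire_space_def PiE_UNIV_domain)
  thus ?thesis by blast
qed

lemma cov_meager_min:
  "cov_meager \<in> card_of ` meager_covers" "\<And>\<F>. \<F> \<in> meager_covers \<Longrightarrow> cov_meager \<le>o |\<F>|"
proof -
  have "\<exists>r. r \<in> card_of ` meager_covers \<and> (\<forall>\<F>\<in>meager_covers. r \<le>o |\<F>| )"
    using exists_minim_Card_order[of "card_of ` meager_covers"] meager_covers_nonempty
    by (auto simp: card_of_Card_order)
  from someI_ex[OF this]
  show "cov_meager \<in> card_of ` meager_covers" "\<And>\<F>. \<F> \<in> meager_covers \<Longrightarrow> cov_meager \<le>o |\<F>|"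
    unfolding cov_meager_def by auto
qed

end

theory Submission
  imports Defs
begin

text \<open>
  Fix a finite set \<open>s\<close> of parameters from the towers. The \<open>\<omega>\<close>-covers may be taken countable, with
  members depending only on finitely many coordinates. By a Galvin--Miller argument, combined with
  \<open>S\<^sub>1(\<Omega>,\<Gamma>)\<close> for \<open>Y\<close>, one chooses members \<open>V\<^sub>0, V\<^sub>1, \<dots>\<close> of the covers and an increasing sequence \<open>a\<close> such
  that, for each \<open>y\<close>, almost every \<open>V\<^sub>j\<close> contains all points \<open>(x, y)\<close> whose coordinates lie in \<open>s\<close> or
  miss \<open>[a(j), a(j+1))\<close>. The tower property provides an infinite set \<open>b\<close> of indices \<open>j\<close> and a set of
  fewer than \<open>\<kappa>\<close> exceptional elements, outside of which the sequence \<open>(V\<^sub>j)\<close>, \<open>j \<in> b\<close>, captures every point.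
  Closing off under \<open>s \<mapsto>\<close> exceptional elements gives a set \<open>S\<close> with \<open>|S| < cov(\<M>)\<close> that contains the
  exceptional elements of each of its finite subsets; this is where \<open>\<kappa>\<close> regular (or else
  \<open>|\<kappa>|\<^sup>+ \<le> cov(\<M>)\<close>) is used. For each finite \<open>s \<subseteq> S\<close> the set of selections agreeing with that of \<open>s\<close>
  infinitely often on \<open>b\<close> is comeager, so a single selection works for all \<open>s\<close> at once. Given a finite
  set \<open>F\<close> of points, apply this to the set \<open>s\<close> of those of its coordinates that lie in \<open>S\<close>.
\<close>

section \<open>Selections from omega-families\<close>

text \<open>Members may be the whole space, unlike in an omega-cover: the sets
  \<open>core k V\<close> formed later can be all of \<open>Y\<close>.\<close>

definition omega_family :: "'a topology \<Rightarrow> 'a set set \<Rightarrow> bool" where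
  "omega_family T \<U> \<longleftrightarrow>
    (\<forall>U\<in>\<U>. openin T U) \<and> (\<forall>F. finite F \<and> F \<subseteq> topspace T \<longrightarrow> (\<exists>U\<in>\<U>. F \<subseteq> U))"

lemma omega_family_finite_Int:
  fixes \<U> :: "nat \<Rightarrow> 'a set set"
  assumes "\<And>n. omega_family T (\<U> n)"
  shows "omega_family T {\<Inter>(u ` {..n}) | u. \<forall>i\<le>n. u i \<in> \<U> i}"
  unfolding omega_family_def
proof (intro conjI ballI allI impI)
  fix U assume "U \<in> {\<Inter>(u ` {..n}) | u. \<forall>i\<le>n. u i \<in> \<U> i}"
  then obtain u where u: "U = \<Inter>(u ` {..n})" "\<forall>i\<le>n. u i \<in> \<U> i" by auto
  have "openin T (u i)" if "i \<le> n" for i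
    using u(2) assms[of i] that unfolding omega_family_def by blast
  then show "openin T U" unfolding u(1) by (intro openin_Inter) auto
next
  fix F assume F: "finite F \<and> F \<subseteq> topspace T"
  have "\<exists>U. U \<in> \<U> i \<and> F \<subseteq> U" for i
    using assms[of i] F unfolding omega_family_def by blast
  then obtain u where "\<And>i. u i \<in> \<U> i \<and> F \<subseteq> u i" by metis
  then show "\<exists>U\<in>{\<Inter>(u ` {..n}) | u. \<forall>i\<le>n. u i \<in> \<U> i}. F \<subseteq> U"
    by (intro bexI[of _ "\<Inter>(u ` {..n})"]) auto
qed

text \<open>
  The Gerlits--Nagy argument: \<open>(\<Omega> choose \<Gamma>)\<close> implies \<open>S\<^sub>1(\<Omega>,\<Gamma>)\<close>. Removing a point \<open>p n\<close> from
  the members of the \<open>n\<close>-th family forces a \<open>\<gamma>\<close>-subcover of the union of all families to take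
  only finitely many members from each of them.
\<close>
lemma Omega_choose_Gamma_selection:
  fixes \<U> :: "nat \<Rightarrow> 'a set set"
  assumes T: "Omega_choose_Gamma T" "t1_space T"
    and \<U>: "\<And>n. omega_family T (\<U> n)"
  obtains u where "\<And>n. u n \<in> \<U> n" "\<And>x. x \<in> topspace T \<Longrightarrow> finite {n. x \<notin> u n}"
proof (cases "finite (topspace T)")
  \<comment> \<open>A finite space lies inside a single member of each family. There is no injective
    sequence \<open>p\<close> in this case.\<close>
  case True
  have "\<exists>U. U \<in> \<U> n \<and> topspace T \<subseteq> U" for n
    using \<U>[of n] True unfolding omega_family_def by blast
  then obtain u where "\<And>n. u n \<in> \<U> n \<and> topspace T \<subseteq> u n" by metis
  then show ?thesis by (intro that[of u]) (auto simp: subset_iff)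
next
  case False
  then obtain p :: "nat \<Rightarrow> 'a" where p: "inj p" "range p \<subseteq> topspace T"
    using infinite_countable_subset by metis
  \<comment> \<open>Common refinements: a member selected at an index \<open>i \<ge> n\<close> still
    lies inside a member of \<open>\<U> n\<close>, so skipped indices can be filled in.\<close>
  define \<W> where "\<W> n = {\<Inter>(u ` {..n}) | u. \<forall>i\<le>n. u i \<in> \<U> i}" for n
  have \<W>: "omega_family T (\<W> n)" for n
    unfolding \<W>_def by (rule omega_family_finite_Int[OF \<U>])
  define \<C> where "\<C> = {W - {p n} | W n. W \<in> \<W> n}"
  have sub: "\<exists>V\<in>\<C>. F \<subseteq> V" if F: "finite F" "F \<subseteq> topspace T" for F
  proof -
    obtain n where "p n \<notin> F"
      using F(1) p(1) by (metis finite_imageD finite_subset image_subset_iff infinite_UNIV_nat)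
    moreover obtain W where "W \<in> \<W> n" "F \<subseteq> W"
      using \<W>[of n] F unfolding omega_family_def by blast
    ultimately have "W - {p n} \<in> \<C>" "F \<subseteq> W - {p n}" unfolding \<C>_def by auto
    then show ?thesis by blast
  qed
  have \<C>open: "openin T V \<and> V \<subset> topspace T" if V: "V \<in> \<C>" for V
  proof -
    obtain W n where W: "V = W - {p n}" "W \<in> \<W> n" using V unfolding \<C>_def by blast
    have "openin T W" using \<W>[of n] W(2) unfolding omega_family_def by blast
    moreover have "p n \<in> topspace T" using p(2) by blast
    ultimately show ?thesis
      using T(2) W(1) openin_subset[of T W]
      by (auto simp: t1_space_closedin_singleton intro: openin_diff)
  qed
  have "\<Union>\<C> = topspace T"
  proof
    show "\<Union>\<C> \<subseteq> topspace T" using \<C>open by blast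
    show "topspace T \<subseteq> \<Union>\<C>"
    proof
      fix x assume "x \<in> topspace T"
      then show "x \<in> \<Union>\<C>" using sub[of "{x}"] by auto
    qed
  qed
  then have "\<C> \<in> omega_covers T"
    unfolding omega_covers_def is_cover_def using \<C>open sub by simp
  then obtain \<V> where \<V>: "\<V> \<subseteq> \<C>" "gamma_cover T \<V>"
    using T(1) unfolding Omega_choose_Gamma_def by blast
  have "\<forall>V\<in>\<V>. \<exists>W n. W \<in> \<W> n \<and> V = W - {p n}" using \<V>(1) unfolding \<C>_def by blast
  then obtain w i where wi: "\<And>V. V \<in> \<V> \<Longrightarrow> w V \<in> \<W> (i V) \<and> V = w V - {p (i V)}"
    by metis
  have fin: "finite {V\<in>\<V>. i V = n}" for n
  proof -
    have "p n \<in> topspace T" using p(2) by blast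
    then have "finite {V\<in>\<V>. p n \<notin> V}" using \<V>(2) unfolding gamma_cover_def by blast
    moreover have "{V\<in>\<V>. i V = n} \<subseteq> {V\<in>\<V>. p n \<notin> V}" using wi by blast
    ultimately show ?thesis by (rule finite_subset[rotated])
  qed
  have "\<exists>V\<in>\<V>. n \<le> i V" for n
  proof (rule ccontr)
    assume "\<not> ?thesis"
    then have "\<V> \<subseteq> (\<Union>k<n. {V\<in>\<V>. i V = k})" by (auto simp: not_le)
    then have "finite \<V>" using fin by (meson finite_UN finite_lessThan finite_subset)
    then show False using \<V>(2) unfolding gamma_cover_def by simp
  qed
  then obtain v where v: "\<And>n. v n \<in> \<V> \<and> n \<le> i (v n)" by metis
  have "\<exists>U. U \<in> \<U> n \<and> v n \<subseteq> U" for n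
  proof -
    obtain u where "w (v n) = \<Inter>(u ` {..i (v n)})" "\<forall>j\<le>i (v n). u j \<in> \<U> j"
      using wi[of "v n"] v[of n] unfolding \<W>_def by blast
    then have "u n \<in> \<U> n" "w (v n) \<subseteq> u n" using v[of n] by auto
    then show ?thesis using wi[of "v n"] v[of n] by blast
  qed
  then obtain u where u: "\<And>n. u n \<in> \<U> n \<and> v n \<subseteq> u n" by metis
  show ?thesis
  proof (rule that[of u])
    show "u n \<in> \<U> n" for n using u by blast
    fix x assume "x \<in> topspace T"
    then have "finite {V\<in>\<V>. x \<notin> V}" using \<V>(2) unfolding gamma_cover_def by blast
    \<comment> \<open>One \<open>V\<close> may serve as \<open>v n\<close> for several
      \<open>n\<close>, but only for \<open>n \<le> i V\<close>; finitely many bad \<open>V\<close>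
      thus give finitely many bad \<open>n\<close>.\<close>
    then have "finite (\<Union>V\<in>{V\<in>\<V>. x \<notin> V}. {..i V})" by blast
    moreover have "{n. x \<notin> u n} \<subseteq> (\<Union>V\<in>{V\<in>\<V>. x \<notin> V}. {..i V})"
    proof
      fix n assume "n \<in> {n. x \<notin> u n}"
      then have "x \<notin> v n" using u by blast
      then show "n \<in> (\<Union>V\<in>{V\<in>\<V>. x \<notin> V}. {..i V})" using v by blast
    qed
    ultimately show "finite {n. x \<notin> u n}" by (rule finite_subset[rotated])
  qed
qed

subsection \<open>Generalized towers\<close>

text \<open>Translates between infinite sets, as in the definition of towers, and increasing
  sequences, which the recursion for \<open>a\<close> produces.\<close>

lemma enumerate_range:
  assumes "strict_mono (a :: nat \<Rightarrow> nat)"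
  shows "enumerate (range a) n = a n"
proof (induction n)
  case 0
  have "(LEAST k. k \<in> range a) = a 0"
    by (rule Least_equality) (use assms in \<open>auto simp: strict_mono_less_eq\<close>)
  then show ?case by (simp add: enumerate_0)
next
  case (Suc n)
  have "(LEAST k. k \<in> range a \<and> a n < k) = a (Suc n)"
    by (rule Least_equality) (use assms in \<open>auto simp: strict_mono_less strict_mono_less_eq\<close>)
  moreover have "infinite (range a)"
    using assms by (simp add: finite_image_iff strict_mono_imp_inj_on)
  ultimately show ?case by (simp add: enumerate_Suc'' Suc.IH)
qed

text \<open>Stated apart from \<open>generalized_tower\<close> so that it covers the empty set and
  finite unions, and so that the bound may be a cardinal above \<kappa>.\<close>

definition tower_like :: "'r rel \<Rightarrow> nat set set \<Rightarrow> bool" where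
  "tower_like r X \<longleftrightarrow>
    (\<forall>a :: nat \<Rightarrow> nat. strict_mono a \<longrightarrow>
      (\<exists>b S. infinite b \<and> S \<subseteq> X \<and> |S| <o r \<and>
        (\<forall>x \<in> X - S. finite (x \<inter> (\<Union>n\<in>b. {a n ..< a (Suc n)})))))"

lemma generalized_tower_imp_tower_like:
  assumes "generalized_tower \<kappa> X" and "\<And>S :: nat set set. |S| <o \<kappa> \<Longrightarrow> |S| <o r"
  shows "tower_like r X"
  unfolding tower_like_def
proof (intro allI impI)
  fix a :: "nat \<Rightarrow> nat" assume a: "strict_mono a"
  then have "infinite (range a)" by (simp add: finite_image_iff strict_mono_imp_inj_on)
  then obtain b S where "infinite b" "S \<subseteq> X" "|S| <o \<kappa>"
      "\<forall>x \<in> X - S. finite (x \<inter>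
        (\<Union>n\<in>b. {enumerate (range a) n ..< enumerate (range a) (Suc n)}))"
    using assms(1) unfolding generalized_tower_def by meson
  then show "\<exists>b S. infinite b \<and> S \<subseteq> X \<and> |S| <o r \<and>
        (\<forall>x \<in> X - S. finite (x \<inter> (\<Union>n\<in>b. {a n ..< a (Suc n)})))"
    using assms(2) unfolding enumerate_range[OF a] by blast
qed

lemma card_of_finite_ordLess:
  assumes "finite A" "Card_order r" "infinite (Field r)"
  shows "|A| <o r"
  using assms
  by (intro finite_ordLess_infinite) (simp_all add: card_of_well_order_on card_order_on_well_order_on Field_card_of)

lemma tower_like_empty:
  assumes "Card_order r" "infinite (Field r)"
  shows "tower_like r {}"
proof -
  have "|{} :: nat set set| <o r"
    using assms by (simp add: card_of_finite_ordLess)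
  then show ?thesis unfolding tower_like_def by (auto intro!: exI[of _ UNIV])
qed

text \<open>Apply the property of \<open>X\<close> to \<open>a\<close>, which gives
  \<open>b\<close>, then that of \<open>X'\<close> to the subsequence of \<open>a\<close> indexed by
  \<open>b\<close>. The intervals of the subsequence contain the original ones with index in
  \<open>b\<close>, so missing a coarse interval implies missing the fine one.\<close>

lemma tower_like_Un:
  assumes r: "Card_order r" "infinite (Field r)"
    and X: "tower_like r X" and X': "tower_like r X'"
  shows "tower_like r (X \<union> X')"
  unfolding tower_like_def
proof (intro allI impI)
  fix a :: "nat \<Rightarrow> nat" assume a: "strict_mono a"
  obtain b S where b: "infinite b" "S \<subseteq> X" "|S| <o r"
    and S: "\<And>x. x \<in> X - S \<Longrightarrow> finite (x \<inter> (\<Union>n\<in>b. {a n ..< a (Suc n)}))"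
    using X a unfolding tower_like_def by meson
  let ?e = "enumerate b"
  have e: "strict_mono ?e" using b(1) by (simp add: strict_mono_def)
  have "strict_mono (a \<circ> ?e)" using a e by (simp add: strict_mono_def)
  then obtain c S' where c: "infinite c" "S' \<subseteq> X'" "|S'| <o r"
    and S': "\<And>x. x \<in> X' - S' \<Longrightarrow> finite (x \<inter> (\<Union>n\<in>c. {(a \<circ> ?e) n ..< (a \<circ> ?e) (Suc n)}))"
    using X' unfolding tower_like_def by meson
  have "infinite (?e ` c)"
    using c(1) e by (simp add: finite_image_iff strict_mono_imp_inj_on)
  moreover have "|S \<union> S'| <o r"
    using card_of_Un_ordLess_infinite_Field r b(3) c(3) by blast
  moreover have "finite (x \<inter> (\<Union>n\<in>?e ` c. {a n ..< a (Suc n)}))"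
    if "x \<in> X \<union> X' - (S \<union> S')" for x
  proof (cases "x \<in> X")
    case True
    then have "finite (x \<inter> (\<Union>n\<in>b. {a n ..< a (Suc n)}))" using S that by blast
    moreover have "?e ` c \<subseteq> b" using b(1) by (auto simp: enumerate_in_set)
    then have "x \<inter> (\<Union>n\<in>?e ` c. {a n ..< a (Suc n)}) \<subseteq> x \<inter> (\<Union>n\<in>b. {a n ..< a (Suc n)})"
      by blast
    ultimately show ?thesis by (rule finite_subset[rotated])
  next
    case False
    then have "finite (x \<inter> (\<Union>n\<in>c. {(a \<circ> ?e) n ..< (a \<circ> ?e) (Suc n)}))" using S' that by blast
    moreover have "{a (?e n) ..< a (Suc (?e n))} \<subseteq> {a (?e n) ..< a (?e (Suc n))}" for n
    proof -
      have "Suc (?e n) \<le> ?e (Suc n)" using e by (simp add: strict_mono_def Suc_leI)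
      then have "a (Suc (?e n)) \<le> a (?e (Suc n))" using a by (simp add: strict_mono_less_eq)
      then show ?thesis by auto
    qed
    then have "x \<inter> (\<Union>n\<in>?e ` c. {a n ..< a (Suc n)})
        \<subseteq> x \<inter> (\<Union>n\<in>c. {(a \<circ> ?e) n ..< (a \<circ> ?e) (Suc n)})"
      by fastforce
    ultimately show ?thesis by (rule finite_subset[rotated])
  qed
  ultimately show "\<exists>b S. infinite b \<and> S \<subseteq> X \<union> X' \<and> |S| <o r \<and>
      (\<forall>x \<in> X \<union> X' - S. finite (x \<inter> (\<Union>n\<in>b. {a n ..< a (Suc n)})))"
    using b(2) c(2) by (intro exI[of _ "?e ` c"] exI[of _ "S \<union> S'"]) blast
qed

lemma tower_like_UN:
  assumes "Card_order r" "infinite (Field r)" "finite I" "\<And>i. i \<in> I \<Longrightarrow> tower_like r (X i)"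
  shows "tower_like r (\<Union>i\<in>I. X i)"
  using assms(3,4)
  by (induction I rule: finite_induct) (simp_all add: assms(1,2) tower_like_empty tower_like_Un)

subsection \<open>Closure under finite subsets\<close>

text \<open>Split by cardinality: inserting one point into an \<open>n\<close>-element set gives all
  \<open>n+1\<close>-element sets, so each level has size at most \<open>|A|\<close>, and there are
  countably many levels.\<close>

lemma card_of_Fpow_ordLeq:
  assumes "infinite A"
  shows "|Fpow A| \<le>o |A|"
proof -
  define P where "P n = {F. F \<subseteq> A \<and> finite F \<and> card F = n}" for n
  have "|P n| \<le>o |A|" for n
  proof (induction n)
    case 0
    have "P 0 = {{}}" unfolding P_def by auto
    moreover have "A \<noteq> {}" using assms by auto
    ultimately show ?case by (simp add: card_of_singl_ordLeq)
  next
    case (Suc n)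
    have "P (Suc n) \<subseteq> (\<Union>a\<in>A. insert a ` P n)"
    proof
      fix F assume "F \<in> P (Suc n)"
      then obtain a G where "F = insert a G" "a \<notin> G" "card G = n" "F \<subseteq> A" "finite F"
        unfolding P_def by (auto simp: card_Suc_eq)
      then show "F \<in> (\<Union>a\<in>A. insert a ` P n)" unfolding P_def by auto
    qed
    moreover have "|insert a ` P n| \<le>o |A|" for a
      using Suc card_of_image ordLeq_transitive by blast
    then have "|\<Union>a\<in>A. insert a ` P n| \<le>o |A|"
      using assms by (intro card_of_UNION_ordLeq_infinite) (simp_all add: card_of_mono1)
    ultimately show ?case using card_of_mono1 ordLeq_transitive by blast
  qed
  moreover have "|UNIV :: nat set| \<le>o |A|" using assms infinite_iff_card_of_nat by blast
  ultimately have "|\<Union>n. P n| \<le>o |A|" using assms by (intro card_of_UNION_ordLeq_infinite) auto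
  moreover have "Fpow A = (\<Union>n. P n)" unfolding Fpow_def P_def by auto
  ultimately show ?thesis by simp
qed

lemma card_of_Fpow_ordLess:
  assumes "|A| <o r" "Card_order r" "infinite (Field r)"
  shows "|Fpow A| <o r"
proof (cases "finite A")
  case True
  then have "finite (Fpow A)" by (simp add: Fpow_def)
  then show ?thesis
    using assms by (simp add: card_of_finite_ordLess)
next
  case False
  then show ?thesis using card_of_Fpow_ordLeq assms(1) ordLeq_ordLess_trans by blast
qed

lemma infinite_Field_if_nat_ordLess:
  assumes "Card_order r" "|UNIV :: nat set| <o r"
  shows "infinite (Field r)"
proof
  assume "finite (Field r)"
  then have "|Field r| <o |UNIV :: nat set|"
    by (intro card_of_finite_ordLess card_of_Card_order) (simp_all add: Field_card_of)
  then have "r <o |UNIV :: nat set|"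
    using card_of_Field_ordIso[OF assms(1)] ordIso_ordLess_trans ordIso_symmetric by blast
  then show False using assms(2) ordLess_transitive ordLess_irreflexive by blast
qed

text \<open>Iterate \<open>\<Phi>\<close> over finite subsets \<omega> times from the empty set.
  Regularity keeps every stage below \<open>r\<close>, and also their union, since \<open>r\<close>
  is uncountable. A finite subset of the union already lies in one stage.\<close>

lemma Fpow_closure:
  fixes \<Phi> :: "'a set \<Rightarrow> 'a set"
  assumes r: "Card_order r" "regularCard r" "|UNIV :: nat set| <o r"
    and \<Phi>: "\<And>s. finite s \<Longrightarrow> |\<Phi> s| <o r"
  shows "\<exists>S. |S| <o r \<and> (\<forall>s. finite s \<longrightarrow> s \<subseteq> S \<longrightarrow> \<Phi> s \<subseteq> S)"
proof -
  have inf: "infinite (Field r)" using r(1,3) by (rule infinite_Field_if_nat_ordLess)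
  have stable: "stable r" using regularCard_stable[OF r(1) inf r(2)] .
  define A where "A n = ((\<lambda>S. S \<union> (\<Union>s\<in>Fpow S. \<Phi> s)) ^^ n) {}" for n
  have A_Suc: "A (Suc n) = A n \<union> (\<Union>s\<in>Fpow (A n). \<Phi> s)" for n unfolding A_def by simp
  have "|A n| <o r" for n
  proof (induction n)
    case 0
    then show ?case unfolding A_def using r(1) inf by (simp add: card_of_finite_ordLess)
  next
    case (Suc n)
    have "|\<Union>s\<in>Fpow (A n). \<Phi> s| <o r"
      by (rule stable_UNION[OF stable card_of_Fpow_ordLess[OF Suc r(1) inf]])
        (simp add: Fpow_def \<Phi>)
    then show ?case unfolding A_Suc using card_of_Un_ordLess_infinite_Field[OF inf r(1) Suc] by blast
  qed
  then have "|\<Union>n. A n| <o r" using stable_UNION[OF stable r(3)] by blast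
  moreover have "\<Phi> s \<subseteq> (\<Union>n. A n)" if s: "finite s" "s \<subseteq> (\<Union>n. A n)" for s
  proof -
    have A: "incseq A" using A_Suc by (intro incseq_SucI) blast
    have "\<exists>n. s \<subseteq> A n" using s
    proof (induction s rule: finite_induct)
      case (insert x s)
      then obtain n k where "s \<subseteq> A n" "x \<in> A k" by auto
      then have "insert x s \<subseteq> A (max n k)"
        using monoD[OF A, of n "max n k"] monoD[OF A, of k "max n k"] by auto
      then show ?case ..
    qed simp
    then obtain n where "s \<in> Fpow (A n)" using s(1) unfolding Fpow_def by blast
    then show ?thesis using A_Suc[of n] by blast
  qed
  ultimately show ?thesis by blast
qed

subsection \<open>Guessing functions below the covering number\<close>

text \<open>The set is closed. A basic open set restricts finitely many coordinates, so some free
  \<open>n \<ge> N\<close> in \<open>b\<close> can be given the value \<open>f n\<close>, which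
  leaves the set.\<close>

lemma nowhere_dense_avoiding:
  fixes f :: "nat \<Rightarrow> nat"
  assumes b: "infinite b"
  shows "nowhere_dense_in baire_space {g. \<forall>n\<in>b. N \<le> n \<longrightarrow> g n \<noteq> f n}"
proof -
  let ?A = "{g. \<forall>n\<in>b. N \<le> n \<longrightarrow> g n \<noteq> f n}"
  have "openin baire_space (- ?A)"
    unfolding baire_space_def openin_product_topology_alt
  proof (intro conjI ballI)
    fix g assume "g \<in> - ?A"
    then obtain n where n: "n \<in> b" "N \<le> n" "g n = f n" by auto
    let ?U = "\<lambda>i. if i = n then {f n} else UNIV"
    have "finite {i. ?U i \<noteq> topspace (discrete_topology UNIV)}"
      by (rule finite_subset[of _ "{n}"]) auto
    moreover have "\<forall>i\<in>UNIV. openin (discrete_topology UNIV) (?U i)" by simp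
    moreover have "g \<in> Pi\<^sub>E UNIV ?U" using n by (simp add: PiE_UNIV_domain)
    moreover have "Pi\<^sub>E UNIV ?U \<subseteq> - ?A"
    proof
      fix h assume "h \<in> Pi\<^sub>E UNIV ?U"
      then have "h n \<in> ?U n" by blast
      then show "h \<in> - ?A" using n by auto
    qed
    ultimately show "\<exists>U. finite {i \<in> UNIV. U i \<noteq> topspace (discrete_topology UNIV)} \<and>
        (\<forall>i\<in>UNIV. openin (discrete_topology UNIV) (U i)) \<and> g \<in> Pi\<^sub>E UNIV U \<and> Pi\<^sub>E UNIV U \<subseteq> - ?A"
      by (intro exI[of _ ?U]) simp
  qed
  moreover have ts: "topspace baire_space = UNIV" by (simp add: baire_space_def PiE_UNIV_domain)
  ultimately have "closedin baire_space ?A" by (simp add: closedin_def Compl_eq_Diff_UNIV)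
  moreover have "g \<notin> baire_space interior_of ?A" for g
  proof
    define W where "W = baire_space interior_of ?A"
    assume "g \<in> baire_space interior_of ?A"
    then have "g \<in> W" "openin baire_space W" "W \<subseteq> ?A"
      unfolding W_def by (simp_all only: openin_interior_of interior_of_subset)
    then obtain U where U: "finite {i. U i \<noteq> UNIV}" "g \<in> Pi\<^sub>E UNIV U" "Pi\<^sub>E UNIV U \<subseteq> ?A"
      unfolding baire_space_def openin_product_topology_alt by fastforce
    have "infinite (b - ({i. U i \<noteq> UNIV} \<union> {..<N}))" using b U(1) by simp
    then obtain n where "n \<in> b - ({i. U i \<noteq> UNIV} \<union> {..<N})"
      using infinite_imp_nonempty by blast
    then have n: "n \<in> b" "U n = UNIV" "N \<le> n" by auto
    have "g(n := f n) \<in> Pi\<^sub>E UNIV U" using U(2) n(2) by (auto simp: PiE_UNIV_domain Pi_iff)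
    then have "g(n := f n) \<in> ?A" using U(3) by blast
    then show False using n by auto
  qed
  ultimately show ?thesis
    unfolding nowhere_dense_in_def by (simp only: ts closure_of_closedin) blast
qed

text \<open>For each \<open>s\<close>, the functions agreeing with \<open>f s\<close> only finitely
  often on \<open>b s\<close> form a meager set; fewer than cov(M) of these cannot cover the Baire
  space.\<close>

lemma cov_meager_guessing:
  fixes f :: "'s \<Rightarrow> nat \<Rightarrow> nat"
  assumes A: "|A| <o cov_meager" and b: "\<And>s. s \<in> A \<Longrightarrow> infinite (b s)"
  shows "\<exists>g. \<forall>s\<in>A. infinite {n\<in>b s. g n = f s n}"
proof -
  define M where "M s = {g. finite {n\<in>b s. g n = f s n}}" for s
  have meager: "meager_in baire_space (M s)" if "s \<in> A" for s
  proof -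
    let ?N = "\<lambda>N. {g. \<forall>n\<in>b s. N \<le> n \<longrightarrow> g n \<noteq> f s n}"
    have "M s = \<Union>(range ?N)"
    proof (intro equalityI subsetI)
      fix g assume "g \<in> M s"
      then obtain N where "\<forall>n\<in>{n\<in>b s. g n = f s n}. n < N"
        unfolding M_def using finite_nat_set_iff_bounded by auto
      then have "g \<in> ?N N" by (auto simp: not_le)
      then show "g \<in> \<Union>(range ?N)" by blast
    next
      fix g assume "g \<in> \<Union>(range ?N)"
      then obtain N where "\<forall>n\<in>b s. N \<le> n \<longrightarrow> g n \<noteq> f s n" by blast
      then have "{n\<in>b s. g n = f s n} \<subseteq> {..<N}" by (auto simp flip: not_le)
      then show "g \<in> M s" unfolding M_def using finite_subset by blast
    qed
    then show ?thesis unfolding meager_in_def using nowhere_dense_avoiding[OF b[OF that]]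
      by (intro exI[of _ "range ?N"]) auto
  qed
  have "\<Union>(M ` A) \<noteq> UNIV"
  proof
    assume "\<Union>(M ` A) = UNIV"
    then have "M ` A \<in> meager_covers"
      unfolding meager_covers_def using meager by (simp add: baire_space_def PiE_UNIV_domain)
    then have "cov_meager \<le>o |A|" using cov_meager_min(2) card_of_image ordLeq_transitive by blast
    then show False using A not_ordLess_ordLeq by blast
  qed
  then obtain g where "g \<notin> \<Union>(M ` A)" by blast
  then show ?thesis unfolding M_def by blast
qed

subsection \<open>A countable base of the product closed under finite unions\<close>

lemma powerset_space_nbhd:
  assumes "openin powerset_space T" "x \<in> T"
  obtains k where "\<And>x'. x' \<inter> {..<k} = x \<inter> {..<k} \<Longrightarrow> x' \<in> T"
proof -
  obtain W where W: "openin (product_topology (\<lambda>_. discrete_topology (UNIV :: bool set)) UNIV) W"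
      "T = (\<lambda>A n. n \<in> A) -` W"
    using assms(1) unfolding powerset_space_def openin_pullback_topology by auto
  then obtain U where U: "finite {i :: nat. U i \<noteq> (UNIV :: bool set)}"
      "(\<lambda>n. n \<in> x) \<in> Pi\<^sub>E UNIV U" "Pi\<^sub>E UNIV U \<subseteq> W"
    using assms(2) unfolding openin_product_topology_alt by fastforce
  obtain k where k: "\<forall>i\<in>{i. U i \<noteq> UNIV}. i < k" using U(1) finite_nat_set_iff_bounded by blast
  show ?thesis
  proof (rule that[of k])
    fix x' assume eq: "x' \<inter> {..<k} = x \<inter> {..<k}"
    have "(n \<in> x') \<in> U n" for n
    proof (cases "n < k")
      case True
      then have "n \<in> x' \<longleftrightarrow> n \<in> x" using eq by blast
      then show ?thesis using U(2) by (simp add: PiE_UNIV_domain Pi_iff)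
    next
      case False
      then have "U n = UNIV" using k by blast
      then show ?thesis by simp
    qed
    then have "(\<lambda>n. n \<in> x') \<in> Pi\<^sub>E UNIV U" by (simp add: PiE_UNIV_domain)
    then show "x' \<in> T" using U(3) W(2) by blast
  qed
qed

lemma topspace_powerset_space: "topspace powerset_space = UNIV"
  by (simp add: powerset_space_def topspace_pullback_topology PiE_UNIV_domain)

text \<open>Codes the first \<open>k\<close> bits of all coordinates as one subset of
  \<open>I \<times> UNIV\<close>, finite when \<open>I\<close> is, so that only countably many
  values occur.\<close>

definition footprint :: "'i set \<Rightarrow> nat \<Rightarrow> ('i \<Rightarrow> nat set) \<Rightarrow> ('i \<times> nat) set" where
  "footprint I k x = {(i, p). i \<in> I \<and> p < k \<and> p \<in> x i}"

lemma footprint_eq_iff: "footprint I k x = footprint I k x' \<longleftrightarrow> (\<forall>i\<in>I. x i \<inter> {..<k} = x' i \<inter> {..<k})"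
  unfolding footprint_def by (auto simp: set_eq_iff)

lemma footprint_mono:
  assumes "k \<le> l" "footprint I l x = footprint I l x'"
  shows "footprint I k x = footprint I k x'"
proof -
  have "x i \<inter> {..<k} = x i \<inter> {..<l} \<inter> {..<k}" for x :: "'a \<Rightarrow> nat set" and i
    using assms(1) by auto
  then show ?thesis using assms(2) unfolding footprint_eq_iff by metis
qed

lemma finite_footprint: "finite I \<Longrightarrow> finite (footprint I k x)"
  by (rule finite_subset[of _ "I \<times> {..<k}"]) (auto simp: footprint_def)

text \<open>The first factor ranges over all functions, not only those in
  \<open>Pi\<^sub>E I D\<close>; comparison with open sets is made after intersecting with the
  space.\<close>

definition boxes :: "'i set \<Rightarrow> 'y set set \<Rightarrow> (('i \<Rightarrow> nat set) \<times> 'y) set set" where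
  "boxes I B =
    {{x. footprint I k x = t} \<times> Q | k t Q. finite t \<and> t \<subseteq> I \<times> UNIV \<and> Q \<in> B}"

text \<open>Finite unions let a single member contain a whole finite set of points, as refining an
  omega-cover requires.\<close>

definition box_unions :: "'i set \<Rightarrow> 'y set set \<Rightarrow> (('i \<Rightarrow> nat set) \<times> 'y) set set" where
  "box_unions I B = Union ` {\<G>. finite \<G> \<and> \<G> \<subseteq> boxes I B}"

lemma countable_box_unions:
  assumes "finite I" "countable B"
  shows "countable (box_unions I B)"
proof -
  have "countable {t. finite t \<and> t \<subseteq> I \<times> (UNIV :: nat set)}"
    using countable_Collect_finite_subset[of "I \<times> (UNIV :: nat set)"] assms(1)
    by (simp add: countable_finite)
  then have "countable ((\<lambda>(k, t, Q). {x. footprint I k x = t} \<times> Q) `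
      (UNIV \<times> {t. finite t \<and> t \<subseteq> I \<times> (UNIV :: nat set)} \<times> B))"
    using assms(2) by (intro countable_image countable_SIGMA) simp_all
  then have "countable (boxes I B)"
    by (rule countable_subset[rotated]) (force simp: boxes_def)
  then show ?thesis
    unfolding box_unions_def by (intro countable_image countable_Collect_finite_subset)
qed

definition supported :: "'i set \<Rightarrow> nat \<Rightarrow> (('i \<Rightarrow> nat set) \<times> 'y) set \<Rightarrow> bool" where
  "supported I k V \<longleftrightarrow>
    (\<forall>x x' y. footprint I k x = footprint I k x' \<longrightarrow> (x, y) \<in> V \<longrightarrow> (x', y) \<in> V)"

lemma supported_mono:
  assumes "supported I k V" "k \<le> l"
  shows "supported I l V"
  unfolding supported_def
proof (intro allI impI)
  fix x x' y assume "footprint I l x = footprint I l x'" and xy: "(x, y) \<in> V"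
  then have "footprint I k x = footprint I k x'" using footprint_mono assms(2) by blast
  then show "(x', y) \<in> V" using assms(1) xy unfolding supported_def by blast
qed

lemma box_unions_supported:
  assumes "V \<in> box_unions I B"
  shows "\<exists>k. supported I k V"
proof -
  obtain \<G> where \<G>: "finite \<G>" "\<G> \<subseteq> boxes I B" and V: "V = \<Union>\<G>"
    using assms unfolding box_unions_def by blast
  show ?thesis unfolding V using \<G>
  proof (induction \<G> rule: finite_induct)
    case empty
    then show ?case by (simp add: supported_def)
  next
    case (insert G \<G>)
    obtain k where k: "supported I k (\<Union>\<G>)" using insert by auto
    obtain l where l: "supported I l G"
      using insert.prems unfolding boxes_def supported_def by fastforce
    have "supported I (max k l) (\<Union>\<G>)" "supported I (max k l) G"
      using supported_mono k l by (metis max.cobounded1, metis max.cobounded2)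
    then have "supported I (max k l) (\<Union>(insert G \<G>))"
      unfolding supported_def by (metis UnE UnI1 UnI2 Union_insert)
    then show ?case ..
  qed
qed

lemma box_unions_section_open:
  assumes "V \<in> box_unions I B" "\<And>Q. Q \<in> B \<Longrightarrow> openin Y Q"
  shows "openin Y {y. (x, y) \<in> V}"
proof -
  obtain \<G> where \<G>: "\<G> \<subseteq> boxes I B" and V: "V = \<Union>\<G>"
    using assms(1) unfolding box_unions_def by blast
  have "openin Y {y. (x, y) \<in> G}" if G: "G \<in> \<G>" for G
  proof -
    obtain k t Q where Q: "G = {x. footprint I k x = t} \<times> Q" "Q \<in> B"
      using G \<G> unfolding boxes_def by blast
    show ?thesis using assms(2)[OF Q(2)] unfolding Q(1) by (cases "footprint I k x = t") simp_all
  qed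
  then have "openin Y (\<Union>G\<in>\<G>. {y. (x, y) \<in> G})" by blast
  moreover have "(\<Union>G\<in>\<G>. {y. (x, y) \<in> G}) = {y. (x, y) \<in> V}" unfolding V by blast
  ultimately show ?thesis by simp
qed

lemma openin_product_box:
  fixes D :: "'i \<Rightarrow> nat set set"
  assumes I: "finite I"
    and B: "\<And>U y. openin Y U \<Longrightarrow> y \<in> U \<Longrightarrow> \<exists>Q\<in>B. y \<in> Q \<and> Q \<subseteq> U"
    and U: "openin (prod_topology (product_topology (\<lambda>i. subtopology powerset_space (D i)) I) Y) U"
    and xy: "(x, y) \<in> U"
  shows "\<exists>G\<in>boxes I B. (x, y) \<in> G \<and> G \<inter> (Pi\<^sub>E I D \<times> topspace Y) \<subseteq> U"
proof -
  obtain W R where W: "openin (product_topology (\<lambda>i. subtopology powerset_space (D i)) I) W"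
      "x \<in> W" and R: "openin Y R" "y \<in> R" and WR: "W \<times> R \<subseteq> U"
    using U[unfolded openin_prod_topology_alt, rule_format, OF xy] by blast
  obtain Q where Q: "Q \<in> B" "y \<in> Q" "Q \<subseteq> R" using B R by blast
  obtain S where S: "\<And>i. i \<in> I \<Longrightarrow> openin (subtopology powerset_space (D i)) (S i)"
      "x \<in> Pi\<^sub>E I S" "Pi\<^sub>E I S \<subseteq> W"
    using W(1)[unfolded openin_product_topology_alt, rule_format, OF W(2)] by blast
  have "\<exists>k. \<forall>x'. x' \<in> D i \<and> x' \<inter> {..<k} = x i \<inter> {..<k} \<longrightarrow> x' \<in> S i" if "i \<in> I" for i
  proof -
    obtain T where T: "openin powerset_space T" "S i = T \<inter> D i"
      using S(1)[OF \<open>i \<in> I\<close>] unfolding openin_subtopology by blast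
    have "x i \<in> T" using S(2) T(2) that by auto
    then obtain k where "\<And>x'. x' \<inter> {..<k} = x i \<inter> {..<k} \<Longrightarrow> x' \<in> T"
      using powerset_space_nbhd[OF T(1)] by blast
    then show ?thesis using T(2) by blast
  qed
  then obtain k where k: "\<And>i x'. i \<in> I \<Longrightarrow> x' \<in> D i \<Longrightarrow> x' \<inter> {..<k i} = x i \<inter> {..<k i} \<Longrightarrow> x' \<in> S i"
    by metis
  \<comment> \<open>Finiteness of \<open>I\<close> gives one length that serves for all
    coordinates.\<close>
  obtain l where l: "\<And>i. i \<in> I \<Longrightarrow> k i \<le> l"
    using I by (meson finite_imageI finite_nat_set_iff_bounded_le imageI)
  let ?G = "{x'. footprint I l x' = footprint I l x} \<times> Q"
  have "footprint I l x \<subseteq> I \<times> UNIV" by (auto simp: footprint_def)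
  then have "?G \<in> boxes I B"
    unfolding boxes_def using Q(1) finite_footprint[OF I]
    by blast
  moreover have "(x, y) \<in> ?G" using Q(2) by simp
  moreover have "?G \<inter> (Pi\<^sub>E I D \<times> topspace Y) \<subseteq> U"
  proof clarify
    fix x' y' assume x': "footprint I l x' = footprint I l x" "x' \<in> Pi\<^sub>E I D" and y': "y' \<in> Q"
    have "x' i \<in> S i" if "i \<in> I" for i
    proof (rule k[OF that])
      show "x' i \<in> D i" using x'(2) that by auto
      show "x' i \<inter> {..<k i} = x i \<inter> {..<k i}"
        using footprint_mono[OF l[OF that] x'(1)] that unfolding footprint_eq_iff by blast
    qed
    then have "x' \<in> Pi\<^sub>E I S" using x'(2) by (auto simp: PiE_iff)
    then show "(x', y') \<in> U" using S(3) WR Q(3) y' by blast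
  qed
  ultimately show ?thesis by (intro bexI[of _ ?G] conjI)
qed

lemma openin_product_box_unions:
  fixes D :: "'i \<Rightarrow> nat set set"
  assumes I: "finite I"
    and B: "\<And>U y. openin Y U \<Longrightarrow> y \<in> U \<Longrightarrow> \<exists>Q\<in>B. y \<in> Q \<and> Q \<subseteq> U"
    and U: "openin (prod_topology (product_topology (\<lambda>i. subtopology powerset_space (D i)) I) Y) U"
    and F: "finite F" "F \<subseteq> U"
  shows "\<exists>V\<in>box_unions I B. F \<subseteq> V \<and> V \<inter> (Pi\<^sub>E I D \<times> topspace Y) \<subseteq> U"
proof -
  have "\<forall>z\<in>F. \<exists>G. G \<in> boxes I B \<and> z \<in> G \<and> G \<inter> (Pi\<^sub>E I D \<times> topspace Y) \<subseteq> U"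
  proof
    fix z assume "z \<in> F"
    then have "(fst z, snd z) \<in> U" using F(2) by auto
    from openin_product_box[OF I B U this]
    show "\<exists>G. G \<in> boxes I B \<and> z \<in> G \<and> G \<inter> (Pi\<^sub>E I D \<times> topspace Y) \<subseteq> U" by auto
  qed
  then obtain G where G: "\<And>z. z \<in> F \<Longrightarrow> G z \<in> boxes I B \<and> z \<in> G z \<and>
      G z \<inter> (Pi\<^sub>E I D \<times> topspace Y) \<subseteq> U" by metis
  then have "\<Union>(G ` F) \<in> box_unions I B" unfolding box_unions_def using F(1) by blast
  moreover have "F \<subseteq> \<Union>(G ` F)" "\<Union>(G ` F) \<inter> (Pi\<^sub>E I D \<times> topspace Y) \<subseteq> U" using G by blast+
  ultimately show ?thesis by blast
qed

subsection \<open>The product theorem\<close>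

text \<open>
  A version of the Galvin--Miller lemma with a finite set \<open>s\<close> of parameters: a coordinate that is
  a parameter is kept as it is, the other ones are truncated to the finite set \<open>x i \<inter> {..<a j}\<close>.
\<close>
lemma interval_selection:
  fixes \<V> :: "nat \<Rightarrow> (('i \<Rightarrow> nat set) \<times> 'y) set set"
  assumes Y: "Omega_choose_Gamma Y" "t1_space Y"
    and I: "finite I" and D: "\<And>i. i \<in> I \<Longrightarrow> {x. finite x} \<subseteq> D i"
    and sect: "\<And>n V x. V \<in> \<V> n \<Longrightarrow> openin Y {y. (x, y) \<in> V}"
    and supp: "\<And>n V. V \<in> \<V> n \<Longrightarrow> \<exists>k. supported I k V"
    and cover: "\<And>n F. finite F \<Longrightarrow> F \<subseteq> Pi\<^sub>E I D \<times> topspace Y \<Longrightarrow> \<exists>V\<in>\<V> n. F \<subseteq> V"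
    and s: "finite s"
  obtains a V where "strict_mono a" "\<And>j. V j \<in> \<V> j"
    "\<And>y. y \<in> topspace Y \<Longrightarrow> finite {j. \<exists>x\<in>Pi\<^sub>E I D.
        (\<forall>i\<in>I. x i \<in> s \<or> x i \<inter> {a j ..< a (Suc j)} = {}) \<and> (x, y) \<notin> V j}"
proof -
  \<comment> \<open>Test points: each coordinate is a parameter or a subset of
    \<open>{..<k}\<close>. There are finitely many of them.\<close>
  define P where "P k = Pi\<^sub>E I (\<lambda>i. s \<inter> D i \<union> Pow {..<k})" for k :: nat
  have P: "finite (P k)" "P k \<subseteq> Pi\<^sub>E I D" for k
  proof -
    show "finite (P k)" unfolding P_def using I s by (intro finite_PiE) auto
    have "Pow {..<k} \<subseteq> {x. finite x}" using finite_subset by auto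
    then show "P k \<subseteq> Pi\<^sub>E I D" unfolding P_def using D by (intro PiE_mono) blast
  qed
  \<comment> \<open>The \<open>y\<close> for which \<open>V\<close> contains \<open>(x, y)\<close>
    for every test point \<open>x\<close>. Finiteness of \<open>P k\<close> makes this open, and
    makes \<open>P k \<times> G\<close> finite for finite \<open>G\<close>, so the cores form an
    omega-family.\<close>
  define core where "core k V = (\<Inter>x\<in>P k. {y. (x, y) \<in> V}) \<inter> topspace Y" for k V
  have core: "omega_family Y (core k ` \<V> j)" for k j
    unfolding omega_family_def
  proof (intro conjI ballI allI impI)
    fix Q assume "Q \<in> core k ` \<V> j"
    then show "openin Y Q" unfolding core_def using P(1) sect by (auto intro!: openin_INT)
  next
    fix G assume G: "finite G \<and> G \<subseteq> topspace Y"
    then obtain V where V: "V \<in> \<V> j" "P k \<times> G \<subseteq> V"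
      using cover[of "P k \<times> G" j] P by blast
    then have "G \<subseteq> core k V" unfolding core_def using G by blast
    then show "\<exists>Q\<in>core k ` \<V> j. G \<subseteq> Q" using V(1) by blast
  qed
  \<comment> \<open>All pairs \<open>(k, j)\<close> are handled in a single selection, because the
    value \<open>k = a j\<close> is known only after the sets have been chosen.\<close>
  define \<O> where "\<O> n = (case prod_decode n of (k, j) \<Rightarrow> core k ` \<V> j)" for n
  have "omega_family Y (\<O> n)" for n using core by (simp add: \<O>_def case_prod_beta)
  then obtain u where u: "\<And>n. u n \<in> \<O> n"
      and fin: "\<And>y. y \<in> topspace Y \<Longrightarrow> finite {n. y \<notin> u n}"
    using Omega_choose_Gamma_selection[OF Y] by blast
  have "\<forall>k j. \<exists>V. V \<in> \<V> j \<and> u (prod_encode (k, j)) = core k V"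
  proof (intro allI)
    fix k j
    show "\<exists>V. V \<in> \<V> j \<and> u (prod_encode (k, j)) = core k V"
      using u[of "prod_encode (k, j)"] by (auto simp: \<O>_def)
  qed
  then obtain V where V: "\<And>k j. V k j \<in> \<V> j \<and> u (prod_encode (k, j)) = core k (V k j)"
    unfolding choice_iff by blast
  then have "\<forall>k j. \<exists>K. supported I K (V k j)" using supp by blast
  then obtain K where K: "\<And>k j. supported I (K k j) (V k j)" unfolding choice_iff by blast
  \<comment> \<open>\<open>a (Suc j)\<close> exceeds \<open>a j\<close> and reaches the support
    length of the set chosen for \<open>(a j, j)\<close>, so that set does not see bits from
    \<open>a (Suc j)\<close> on.\<close>
  define a where "a = rec_nat 0 (\<lambda>j r. Suc (max r (K r j)))"
  have a: "a j < a (Suc j)" "K (a j) j \<le> a (Suc j)" for j by (simp_all add: a_def)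
  show ?thesis
  proof (rule that[of a "\<lambda>j. V (a j) j"])
    show "strict_mono a" using a(1) by (simp add: strict_mono_Suc_iff)
    show "V (a j) j \<in> \<V> j" for j using V by blast
    fix y assume y: "y \<in> topspace Y"
    let ?e = "\<lambda>j. prod_encode (a j, j)"
    let ?bad = "{j. \<exists>x\<in>Pi\<^sub>E I D.
        (\<forall>i\<in>I. x i \<in> s \<or> x i \<inter> {a j ..< a (Suc j)} = {}) \<and> (x, y) \<notin> V (a j) j}"
    have "?bad \<subseteq> ?e -` {n. y \<notin> u n}"
    proof clarsimp
      fix j x assume x: "x \<in> Pi\<^sub>E I D"
          "\<forall>i\<in>I. x i \<in> s \<or> x i \<inter> {a j ..< a (Suc j)} = {}" "(x, y) \<notin> V (a j) j"
        and yu: "y \<in> u (?e j)"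
      \<comment> \<open>Truncation turns \<open>x\<close> into a test point without changing it
        below \<open>a (Suc j)\<close>, since a truncated coordinate misses the interval.\<close>
      define x' where "x' = (\<lambda>i\<in>I. if x i \<in> s then x i else x i \<inter> {..<a j})"
      have "x' \<in> P (a j)" unfolding x'_def P_def using x(1) by (auto simp: PiE_iff)
      then have "(x', y) \<in> V (a j) j" using yu V[of "a j" j] by (simp add: core_def)
      moreover have "x' i \<inter> {..<a (Suc j)} = x i \<inter> {..<a (Suc j)}" if "i \<in> I" for i
      proof (cases "x i \<in> s")
        case False
        then have "p < a j" if "p \<in> x i" "p < a (Suc j)" for p
          using x(2) \<open>i \<in> I\<close> that by (metis IntI atLeastLessThan_iff empty_iff not_le)
        then show ?thesis using a(1)[of j] that by (auto simp: x'_def)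
      qed (simp add: x'_def that)
      then have "footprint I (a (Suc j)) x' = footprint I (a (Suc j)) x" unfolding footprint_eq_iff by blast
      ultimately have "(x, y) \<in> V (a j) j"
        using supported_mono[OF K a(2)] unfolding supported_def by blast
      then show False using x(3) by simp
    qed
    \<comment> \<open>The indices \<open>?e j\<close> are distinct, so finitely many failures of
      \<open>u\<close> pull back to finitely many \<open>j\<close>.\<close>
    moreover have "finite (?e -` {n. y \<notin> u n})"
      using fin[OF y] by (intro finite_vimageI) (auto simp: inj_def)
    ultimately show "finite ?bad" by (rule finite_subset)
  qed
qed

text \<open>An interval met by \<open>x\<close> contains a point of the finite set that is at least
  \<open>a n\<close>, and \<open>n \<le> a n\<close>, so its index is bounded.\<close>

lemma finite_met_intervals:
  assumes a: "strict_mono (a :: nat \<Rightarrow> nat)"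
    and fin: "finite (x \<inter> (\<Union>n\<in>b. {a n ..< a (Suc n)}))"
  shows "finite {n\<in>b. x \<inter> {a n ..< a (Suc n)} \<noteq> {}}"
proof -
  obtain M where M: "\<forall>p\<in>x \<inter> (\<Union>n\<in>b. {a n ..< a (Suc n)}). p \<le> M"
    using fin finite_nat_set_iff_bounded_le by blast
  have "{n\<in>b. x \<inter> {a n ..< a (Suc n)} \<noteq> {}} \<subseteq> {..M}"
  proof clarsimp
    fix n assume "n \<in> b" "x \<inter> {a n ..< a (Suc n)} \<noteq> {}"
    then obtain p where "p \<le> M" "a n \<le> p" using M by fastforce
    moreover have "n \<le> a n" using a by (rule strict_mono_imp_increasing)
    ultimately show "n \<le> M" by linarith
  qed
  then show ?thesis using finite_subset by blast
qed

lemma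
  assumes "\<U> \<in> omega_covers T"
  shows omega_covers_open: "U \<in> \<U> \<Longrightarrow> openin T U"
    and omega_covers_psubset: "U \<in> \<U> \<Longrightarrow> U \<subset> topspace T"
    and omega_covers_finite: "finite F \<Longrightarrow> F \<subseteq> topspace T \<Longrightarrow> \<exists>U\<in>\<U>. F \<subseteq> U"
  using assms by (simp_all add: omega_covers_def is_cover_def)

text \<open>The common form of both cases on \<kappa>: \<open>r\<close> will be \<kappa> itself or
  the successor cardinal of \<open>|Field \<kappa>|\<close>.\<close>

theorem S1_Omega_Omega_tower_product:
  fixes X :: "'i \<Rightarrow> nat set set" and r :: "'r rel" and Y :: "'y topology"
  assumes r: "Card_order r" "regularCard r" "|UNIV :: nat set| <o r" "r \<le>o cov_meager"
    and I: "finite I" and X: "\<And>i. i \<in> I \<Longrightarrow> tower_like r (X i)"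
    and Y: "Omega_choose_Gamma Y" "t1_space Y" "second_countable Y"
  shows "S1_Omega_Omega
    (prod_topology (product_topology (\<lambda>i. subtopology powerset_space (X i \<union> {F. finite F})) I) Y)"
proof -
  define D where "D = (\<lambda>i. X i \<union> {F. finite F})"
  define Z where "Z = prod_topology (product_topology (\<lambda>i. subtopology powerset_space (D i)) I) Y"
  have TZ: "topspace Z = Pi\<^sub>E I D \<times> topspace Y"
    by (simp add: Z_def topspace_powerset_space)
  have inf: "infinite (Field r)" using r(1,3) by (rule infinite_Field_if_nat_ordLess)
  obtain B where B: "countable B" "\<And>Q. Q \<in> B \<Longrightarrow> openin Y Q"
      "\<And>U y. openin Y U \<Longrightarrow> y \<in> U \<Longrightarrow> \<exists>Q\<in>B. y \<in> Q \<and> Q \<subseteq> U"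
    using Y(3) unfolding second_countable_def by metis
  define \<B> where "\<B> = box_unions I B"
  have \<B>: "countable \<B>" unfolding \<B>_def using countable_box_unions[OF I B(1)] .
  have "\<exists>U. (\<forall>n. U n \<in> \<U> n) \<and> range U \<in> omega_covers Z"
    if \<U>: "\<And>n. \<U> n \<in> omega_covers Z" for \<U> :: "nat \<Rightarrow> (('i \<Rightarrow> nat set) \<times> 'y) set set"
  proof -
    define \<V> where "\<V> n = {V\<in>\<B>. \<exists>U\<in>\<U> n. V \<inter> topspace Z \<subseteq> U}" for n
    have cover: "\<exists>V\<in>\<V> n. F \<subseteq> V" if F: "finite F" "F \<subseteq> Pi\<^sub>E I D \<times> topspace Y" for n F
    proof -
      have "F \<subseteq> topspace Z" using F(2) TZ by simp
      then obtain U where U: "U \<in> \<U> n" "F \<subseteq> U"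
        using omega_covers_finite[OF \<U> F(1)] by blast
      have UZ: "openin Z U" using omega_covers_open[OF \<U> U(1)] .
      have "\<exists>V\<in>\<B>. F \<subseteq> V \<and> V \<inter> topspace Z \<subseteq> U"
        unfolding \<B>_def TZ
        by (rule openin_product_box_unions[OF I B(3) UZ[unfolded Z_def] F(1) U(2)])
      then show ?thesis unfolding \<V>_def using U(1) by blast
    qed
    define good where "good s a V \<longleftrightarrow> strict_mono a \<and> (\<forall>j. V j \<in> \<V> j) \<and>
        (\<forall>y\<in>topspace Y. finite {j. \<exists>x\<in>Pi\<^sub>E I D.
          (\<forall>i\<in>I. x i \<in> s \<or> x i \<inter> {a j ..< a (Suc j)} = {}) \<and> (x, y) \<notin> V j})"
      for s and a :: "nat \<Rightarrow> nat" and V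
    have "\<exists>a V. good s a V" if s: "finite s" for s
    proof (rule interval_selection[where \<V> = \<V> and D = D, OF Y(1,2) I _ _ _ cover s])
      show "{x. finite x} \<subseteq> D i" for i by (simp add: D_def)
      show "openin Y {y. (x, y) \<in> V}" if "V \<in> \<V> n" for n V x
        using that B(2) unfolding \<V>_def \<B>_def by (blast intro: box_unions_section_open)
      show "\<exists>k. supported I k V" if "V \<in> \<V> n" for n V
        using that unfolding \<V>_def \<B>_def by (blast intro: box_unions_supported)
    qed (auto simp: good_def)
    then obtain a V where good: "\<And>s. finite s \<Longrightarrow> good s (a s) (V s)" by metis
    \<comment> \<open>Taking the union of all towers gives one index set and one exceptional set
      that serve every coordinate.\<close>
    define W where "W = (\<Union>i\<in>I. X i)"
    have W: "tower_like r W" unfolding W_def by (rule tower_like_UN[OF r(1) inf I X])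
    define tame where "tame s b S \<longleftrightarrow> infinite b \<and> |S| <o r \<and>
        (\<forall>x \<in> W - S. finite (x \<inter> (\<Union>n\<in>b. {a s n ..< a s (Suc n)})))" for s b S
    have "\<exists>b S. tame s b S" if "finite s" for s
      using good[OF that] W unfolding tower_like_def good_def tame_def by meson
    then obtain b \<Phi> where tame: "\<And>s. finite s \<Longrightarrow> tame s (b s) (\<Phi> s)" by metis
    have b: "\<And>s. finite s \<Longrightarrow> infinite (b s)"
      and \<Phi>: "\<And>s. finite s \<Longrightarrow> |\<Phi> s| <o r"
      and tower: "\<And>s x. finite s \<Longrightarrow> x \<in> W - \<Phi> s \<Longrightarrow>
          finite (x \<inter> (\<Union>n\<in>b s. {a s n ..< a s (Suc n)}))"
      using tame unfolding tame_def by blast+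
    obtain S where S: "|S| <o r" "\<And>s. finite s \<Longrightarrow> s \<subseteq> S \<Longrightarrow> \<Phi> s \<subseteq> S"
      using Fpow_closure[where \<Phi> = \<Phi>, OF r(1-3) \<Phi>] by blast
    have "|Fpow S| <o cov_meager"
      using card_of_Fpow_ordLess[OF S(1) r(1) inf] r(4) ordLess_ordLeq_trans by blast
    \<comment> \<open>Countability of \<open>\<B>\<close> lets each sequence \<open>V s\<close> be
      coded as a function on the naturals, to be guessed infinitely often along
      \<open>b s\<close>.\<close>
    then have "\<exists>g. \<forall>s\<in>Fpow S. infinite {n\<in>b s. g n = to_nat_on \<B> (V s n)}"
      by (rule cov_meager_guessing) (simp add: Fpow_def b)
    then obtain g where g: "\<And>s. s \<in> Fpow S \<Longrightarrow> infinite {n\<in>b s. g n = to_nat_on \<B> (V s n)}"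
      by blast
    \<comment> \<open>\<open>g n\<close> may code a set outside \<open>\<V> n\<close>; an arbitrary
      member of \<open>\<U> n\<close> is then the default.\<close>
    have "\<exists>U\<in>\<U> n. from_nat_into \<B> (g n) \<in> \<V> n \<longrightarrow> from_nat_into \<B> (g n) \<inter> topspace Z \<subseteq> U" for n
    proof -
      obtain U0 where "U0 \<in> \<U> n" using omega_covers_finite[OF \<U>, of "{}"] by auto
      then show ?thesis unfolding \<V>_def by blast
    qed
    then obtain U where U: "\<And>n. U n \<in> \<U> n"
        "\<And>n. from_nat_into \<B> (g n) \<in> \<V> n \<Longrightarrow> from_nat_into \<B> (g n) \<inter> topspace Z \<subseteq> U n"
      by metis
    have omega: "\<exists>n. F \<subseteq> U n" if F: "finite F" "F \<subseteq> topspace Z" for F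
    proof -
      define A where "A = (\<Union>i\<in>I. (\<lambda>z. fst z i) ` F)"
      \<comment> \<open>A coordinate in \<open>A\<close> but not in \<open>s\<close> is outside
        \<open>S\<close>, hence outside \<open>\<Phi> s\<close>, so the tower property applies to it
        if it is infinite.\<close>
      define s where "s = A \<inter> S"
      have "finite A" unfolding A_def using I F(1) by blast
      then have s: "finite s" "s \<in> Fpow S" unfolding s_def Fpow_def by auto
      have gs: "strict_mono (a s)" "\<And>j. V s j \<in> \<V> j"
        "\<And>y. y \<in> topspace Y \<Longrightarrow> finite {j. \<exists>x\<in>Pi\<^sub>E I D.
          (\<forall>i\<in>I. x i \<in> s \<or> x i \<inter> {a s j ..< a s (Suc j)} = {}) \<and> (x, y) \<notin> V s j}"
        using good[OF s(1)] unfolding good_def by blast+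
      have "finite {n\<in>b s. z \<notin> V s n}" if z: "z \<in> F" for z
      proof -
        obtain x y where xy: "z = (x, y)" "x \<in> Pi\<^sub>E I D" "y \<in> topspace Y"
          using z F(2) TZ by auto
        let ?bad = "{j. \<exists>x\<in>Pi\<^sub>E I D.
          (\<forall>i\<in>I. x i \<in> s \<or> x i \<inter> {a s j ..< a s (Suc j)} = {}) \<and> (x, y) \<notin> V s j}"
        let ?met = "\<lambda>i. {n\<in>b s. x i \<inter> {a s n ..< a s (Suc n)} \<noteq> {}}"
        have "finite (?met i)" if i: "i \<in> I" "x i \<notin> s" for i
        proof (rule finite_met_intervals[OF gs(1)])
          show "finite (x i \<inter> (\<Union>n\<in>b s. {a s n ..< a s (Suc n)}))"
          proof (cases "finite (x i)")
            case False
            then have "x i \<in> W" using xy(2) i(1) unfolding D_def W_def by (auto simp: PiE_iff)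
            moreover have "x i \<in> A" unfolding A_def using i(1) z xy(1) by force
            then have "x i \<notin> \<Phi> s" using i(2) S(2)[OF s(1)] unfolding s_def by blast
            ultimately show ?thesis using tower[OF s(1)] by blast
          qed simp
        qed
        then have "finite (?bad \<union> (\<Union>i\<in>{i\<in>I. x i \<notin> s}. ?met i))"
          using gs(3)[OF xy(3)] I by simp
        \<comment> \<open>If \<open>n\<close> lies in no \<open>?met i\<close>, every coordinate is
          a parameter or misses the interval, so a failure at \<open>n\<close> puts \<open>n\<close>
          in \<open>?bad\<close>.\<close>
        moreover have "{n\<in>b s. z \<notin> V s n} \<subseteq> ?bad \<union> (\<Union>i\<in>{i\<in>I. x i \<notin> s}. ?met i)"
          using xy(1,2) by blast
        ultimately show ?thesis by (rule finite_subset[rotated])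
      qed
      then have "finite (\<Union>z\<in>F. {n\<in>b s. z \<notin> V s n})" using F(1) by blast
      then have "infinite ({n\<in>b s. g n = to_nat_on \<B> (V s n)} - (\<Union>z\<in>F. {n\<in>b s. z \<notin> V s n}))"
        using g[OF s(2)] by (rule Diff_infinite_finite)
      then obtain n where n: "n \<in> b s" "g n = to_nat_on \<B> (V s n)" "\<forall>z\<in>F. z \<in> V s n"
        using infinite_imp_nonempty by blast
      have "V s n \<in> \<V> n" by (rule gs(2))
      moreover from this have "from_nat_into \<B> (g n) = V s n"
        using \<B> n(2) by (simp add: \<V>_def)
      ultimately have "V s n \<inter> topspace Z \<subseteq> U n" using U(2)[of n] by simp
      then show ?thesis using n(3) F(2) by blast
    qed
    have sub: "U n \<subset> topspace Z" "openin Z (U n)" for n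
      using omega_covers_psubset[OF \<U> U(1)] omega_covers_open[OF \<U> U(1)] by simp_all
    have "\<Union>(range U) = topspace Z"
    proof
      show "\<Union>(range U) \<subseteq> topspace Z" using sub(1) by blast
      show "topspace Z \<subseteq> \<Union>(range U)"
      proof
        fix z assume "z \<in> topspace Z"
        then show "z \<in> \<Union>(range U)" using omega[of "{z}"] by blast
      qed
    qed
    then have "range U \<in> omega_covers Z"
      unfolding omega_covers_def is_cover_def using sub omega by simp
    then show ?thesis using U(1) by blast
  qed
  then show ?thesis unfolding S1_Omega_Omega_def Z_def D_def by blast
qed

section \<open>Reduction to a regular uncountable cardinal\<close>

theorem theorem5p6:
  fixes \<kappa> :: "'k rel"
    and m :: nat
    and X :: "nat \<Rightarrow> nat set set"
    and Y :: "'y topology"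
  assumes "uncountable_ordinal \<kappa>"
    and "\<kappa> \<le>o cov_meager"
    and "regular_ordinal \<kappa> \<or> \<kappa> <o cov_meager"
    and "m \<ge> 1"
    and "\<And>i. i \<in> {1..m} \<Longrightarrow> generalized_tower \<kappa> (X i)"
    and "set_of_reals Y"
    and "Omega_choose_Gamma Y"
  shows "S1_Omega_Omega
           (prod_topology
             (product_topology (\<lambda>i. subtopology powerset_space (X i \<union> {F. finite F})) {1..m})
             Y)"
proof -
  obtain A :: "real set" where A: "Y homeomorphic_space top_of_set A"
    using assms(6) unfolding set_of_reals_def by blast
  have Y: "t1_space Y" "second_countable Y"
  proof -
    have "t1_space (top_of_set A)"
      by (simp add: Hausdorff_imp_t1_space Hausdorff_space_subtopology Hausdorff_space_euclidean)
    then show "t1_space Y" using homeomorphic_t1_space[OF A] by simp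
    have "second_countable (euclidean :: real topology)"
    proof -
      obtain \<B> :: "real set set" where "countable \<B>" "\<And>C. C \<in> \<B> \<Longrightarrow> open C"
          "\<And>S. open S \<Longrightarrow> \<exists>U. U \<subseteq> \<B> \<and> S = \<Union>U"
        using univ_second_countable by blast
      moreover from this(3) have "\<exists>V\<in>\<B>. x \<in> V \<and> V \<subseteq> U" if "open U" "x \<in> U" for U x
        using that by (metis Sup_upper UnionE subsetD)
      ultimately show ?thesis
        unfolding second_countable_def open_openin[symmetric] by (intro exI[of _ \<B>]) simp
    qed
    then show "second_countable Y"
      using homeomorphic_space_second_countability[OF A] second_countable_subtopology by blast
  qed
  have \<kappa>: "Well_order \<kappa>" "uncountable (Field \<kappa>)"
    using assms(1) unfolding uncountable_ordinal_def by auto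
  have nat: "|UNIV :: nat set| <o |Field \<kappa>|"
  proof -
    have "\<not> |Field \<kappa>| \<le>o |UNIV :: nat set|"
      using \<kappa>(2) unfolding countable_def card_of_ordLeq[symmetric] by blast
    then show ?thesis
      by (simp only: not_ordLeq_iff_ordLess[OF card_of_Well_order card_of_Well_order])
  qed
  have Field: "|Field \<kappa>| \<le>o \<kappa>" using \<kappa>(1) by (rule card_of_least)
  show ?thesis
  proof (cases "\<kappa> <o cov_meager")
    case True
    \<comment> \<open>Here \<kappa> may be singular or not a cardinal. The successor cardinal is
      regular, and it stays at most cov(M) because \<open>|Field \<kappa>|\<close> is strictly below
      cov(M).\<close>
    let ?r = "cardSuc |Field \<kappa>|"
    have "|UNIV :: nat set| <o ?r"
      using nat cardSuc_greater[OF card_of_Card_order] ordLess_transitive by blast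
    moreover have "regularCard ?r"
      using uncountable_infinite[OF \<kappa>(2)]
      by (intro infinite_cardSuc_regularCard card_of_Card_order) (simp add: Field_card_of)
    moreover have "?r \<le>o cov_meager"
    proof (rule cardSuc_least[OF card_of_Card_order])
      show "Card_order cov_meager" using cov_meager_min(1) by (elim imageE) (metis card_of_Card_order)
      show "|Field \<kappa>| <o cov_meager" using Field True by (rule ordLeq_ordLess_trans)
    qed
    \<comment> \<open>Exceptional sets small for \<kappa> have size at most
      \<open>|Field \<kappa>|\<close>, so they are small for \<open>?r\<close> as well.\<close>
    moreover have less: "|S| <o ?r" if "|S| <o \<kappa>" for S :: "nat set set"
    proof -
      have "|S| \<le>o |Field \<kappa>|"
        using card_of_mono2[OF ordLess_imp_ordLeq[OF that]] by (simp add: Field_card_of)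
      then show ?thesis using cardSuc_greater[OF card_of_Card_order] ordLeq_ordLess_trans by blast
    qed
    moreover have "tower_like ?r (X i)" if "i \<in> {1..m}" for i
      using generalized_tower_imp_tower_like[OF assms(5)[OF that] less] .
    moreover have "Card_order ?r" by (intro cardSuc_Card_order card_of_Card_order)
    ultimately show ?thesis
      using assms(7) Y by (intro S1_Omega_Omega_tower_product[where r = ?r]) simp_all
  next
    case False
    then have "Card_order \<kappa>" "regularCard \<kappa>"
      using assms(3) unfolding regular_ordinal_def by auto
    moreover have "|UNIV :: nat set| <o \<kappa>" using nat Field ordLess_ordLeq_trans by blast
    moreover have "tower_like \<kappa> (X i)" if "i \<in> {1..m}" for i
      using generalized_tower_imp_tower_like[OF assms(5)[OF that]] .
    ultimately show ?thesis
      using assms(2,7) Y by (intro S1_Omega_Omega_tower_product[where r = \<kappa>]) simp_all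
  qed
qed

end
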